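(* Let $g:\mathbb{R}^m\to\overline{\mathbb{R}}$ be a polyhedral function and $(\bar z,\bar\lambda)\in\mathrm{gph}\,\partial g$, and write $K=K_g(\bar z,\bar\lambda)$. Then: (a) $\mathrm{gph}\, D(\partial g)(\bar z,\bar\lambda)=T_{\mathrm{gph}\,\partial g}(\bar z,\bar\lambda)=\mathrm{gph}\, N_K$; (b) $\mathrm{gph}\, D_*(\partial g)(\bar z,\bar\lambda)=\mathrm{gph}\, N_K-\mathrm{gph}\, N_K$; (c) $\bar\lambda\in\mathrm{ri}\,\partial g(\bar z)$ if and only if there exists a neighborhood $O$ of $(\bar z,\bar\lambda)$ such that for every $(z,\lambda)\in O\cap\mathrm{gph}\,\partial g$, the mapping $\partial g$ is strictly proto-differentiable at $z$ for $\lambda$ and $D_*(\partial g)(z,\lambda)=D(\partial g)(z,\lambda)$.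
   Context: A proper function $g:\mathbb{R}^m\to\overline{\mathbb{R}}$ is polyhedral if its epigraph is a polyhedral convex set; $\partial g$ is the convex-analysis subdifferential; $\mathrm{ri}$ is relative interior. For $z$ with $g(z)$ finite, ${\rm d} g(z)(w)=\liminf_{t\searrow 0,\,w'\to w}\frac{g(z+tw')-g(z)}{t}$ and for $\lambda\in\partial g(z)$ the critical cone is $K_g(z,\lambda)=\{w\mid\langle\lambda,w\rangle={\rm d} g(z)(w)\}$. $N_K$ is the convex-analysis normal cone mapping of the convex cone $K$. Set limits are in the Painlevé–Kuratowski sense. For a set $\Omega$ and $\bar x\in\Omega$, the tangent cone is $T_\Omega(\bar x)=\limsup_{t\searrow0}(\Omega-\bar x)/t$. For a set-valued map $F:\mathbb{R}^n\rightrightarrows\mathbb{R}^m$ and $(\bar x,\bar y)\in\mathrm{gph}\, F$: the graphical derivative $DF(\bar x,\bar y)$ has graph $T_{\mathrm{gph}\, F}(\bar x,\bar y)$; the strict graphical derivative $D_*F(\bar x,\bar y)$ has graph $\limsup_{t\searrow0,\,(x,y)\to(\bar x,\bar y),\,(x,y)\in\mathrm{gph}\, F}\frac{\mathrm{gph}\, F-(x,y)}{t}$; $F$ is strictly proto-differentiable at $\bar x$ for $\bar y$ if this outer limit is actually a full limit (i.e., equals the corresponding inner limit). *)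

theory Defs
  imports "HOL-Analysis.Analysis"
begin

definition proper_fun :: "('a \<Rightarrow> ereal) \<Rightarrow> bool" where
  "proper_fun g \<longleftrightarrow> (\<forall>z. g z \<noteq> -\<infinity>) \<and> (\<exists>z. g z \<noteq> \<infinity>)"

definition epigraph :: "(real^'m \<Rightarrow> ereal) \<Rightarrow> ((real^'m) \<times> real) set" where
  "epigraph g = {(z, a). g z \<le> ereal a}"

definition polyhedral_fun :: "(real^'m \<Rightarrow> ereal) \<Rightarrow> bool" where
  "polyhedral_fun g \<longleftrightarrow> proper_fun g \<and> polyhedron (epigraph g)"

definition subdiff :: "(real^'m \<Rightarrow> ereal) \<Rightarrow> real^'m \<Rightarrow> (real^'m) set" where
  "subdiff g z = {l. \<bar>g z\<bar> \<noteq> \<infinity> \<and> (\<forall>w. g z + ereal (l \<bullet> (w - z)) \<le> g w)}"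

definition subderiv :: "(real^'m \<Rightarrow> ereal) \<Rightarrow> real^'m \<Rightarrow> real^'m \<Rightarrow> ereal" where
  "subderiv g z w =
     Liminf (at_right (0::real) \<times>\<^sub>F nhds w)
       (\<lambda>(t, w'). (g (z + t *\<^sub>R w') - g z) / ereal t)"

definition critical_cone :: "(real^'m \<Rightarrow> ereal) \<Rightarrow> real^'m \<Rightarrow> real^'m \<Rightarrow> (real^'m) set" where
  "critical_cone g z l = {w. ereal (l \<bullet> w) = subderiv g z w}"

definition normal_cone_map :: "(real^'m) set \<Rightarrow> real^'m \<Rightarrow> (real^'m) set" where
  "normal_cone_map K w = {v. w \<in> K \<and> (\<forall>u\<in>K. v \<bullet> (u - w) \<le> 0)}"

definition gph :: "('a \<Rightarrow> 'b set) \<Rightarrow> ('a \<times> 'b) set" where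
  "gph F = {(x, y). y \<in> F x}"

definition outer_limit :: "'i filter \<Rightarrow> ('i \<Rightarrow> 'a::metric_space set) \<Rightarrow> 'a set" where
  "outer_limit F A = {v. \<forall>e>0. frequently (\<lambda>p. \<exists>u\<in>A p. dist u v < e) F}"

definition inner_limit :: "'i filter \<Rightarrow> ('i \<Rightarrow> 'a::metric_space set) \<Rightarrow> 'a set" where
  "inner_limit F A = {v. \<forall>e>0. eventually (\<lambda>p. \<exists>u\<in>A p. dist u v < e) F}"

definition tangent_cone :: "'a::real_normed_vector set \<Rightarrow> 'a \<Rightarrow> 'a set" where
  "tangent_cone S x = outer_limit (at_right (0::real)) (\<lambda>t. (\<lambda>y. (1 / t) *\<^sub>R (y - x)) ` S)"

definition strict_filter :: "('a::topological_space) set \<Rightarrow> 'a \<Rightarrow> (real \<times> 'a) filter" where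
  "strict_filter G p = at_right (0::real) \<times>\<^sub>F (inf (nhds p) (principal G))"

definition strict_quot :: "'a::real_normed_vector set \<Rightarrow> real \<times> 'a \<Rightarrow> 'a set" where
  "strict_quot G = (\<lambda>(t, q). (\<lambda>y. (1 / t) *\<^sub>R (y - q)) ` G)"

definition graph_deriv :: "('a::real_normed_vector \<Rightarrow> 'b::real_normed_vector set)
    \<Rightarrow> 'a \<Rightarrow> 'b \<Rightarrow> 'a \<Rightarrow> 'b set" where
  "graph_deriv F x y u = {v. (u, v) \<in> tangent_cone (gph F) (x, y)}"

definition strict_graph_deriv :: "('a::real_normed_vector \<Rightarrow> 'b::real_normed_vector set)
    \<Rightarrow> 'a \<Rightarrow> 'b \<Rightarrow> 'a \<Rightarrow> 'b set" where
  "strict_graph_deriv F x y u =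
     {v. (u, v) \<in> outer_limit (strict_filter (gph F) (x, y)) (strict_quot (gph F))}"

definition strictly_proto_diff :: "('a::real_normed_vector \<Rightarrow> 'b::real_normed_vector set)
    \<Rightarrow> 'a \<Rightarrow> 'b \<Rightarrow> bool" where
  "strictly_proto_diff F x y \<longleftrightarrow>
     outer_limit (strict_filter (gph F) (x, y)) (strict_quot (gph F))
     = inner_limit (strict_filter (gph F) (x, y)) (strict_quot (gph F))"

end

theory Submission
  imports Defs
begin

text \<open>
  Near \<open>(z, g z)\<close> the epigraph of \<open>g\<close> coincides with a translate of a polyhedral cone \<open>T\<close>, so a
  subgradient \<open>l\<close> at \<open>z\<close> has critical cone \<open>K = {w. (w, l \<bullet> w) \<in> T}\<close>. Because \<open>T\<close> is finitely
  generated, \<open>\<partial>g(z)\<close> agrees near \<open>l\<close> with \<open>l\<close> plus the polar of \<open>K\<close>, and it follows that the graph of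
  \<open>\<partial>g\<close> agrees near \<open>(z, l)\<close> with \<open>(z, l) + gph N\<^sub>K\<close> (Robinson's reduction lemma). The graph of \<open>N\<^sub>K\<close>
  is a finite union of products of finitely generated cones; hence it and its set of differences are
  closed, and both graphical derivatives can be read off. Finally \<open>l\<close> is relatively interior iff \<open>K\<close>
  is a subspace, iff the graph of \<open>N\<^sub>K\<close> is a subspace, iff it is closed under differences.
\<close>

subsection \<open>Polyhedra and finitely generated cones\<close>

text \<open>Cutting \<open>P\<close> with a cube around the origin gives a polytope, which has
  finitely many vertices. Every ray of \<open>P\<close> meets the cube, so those vertices already
  generate the whole cone.\<close>

lemma polyhedral_cone_finitely_generated:
  fixes P :: "'a::euclidean_space set"
  assumes "polyhedron P" "convex_cone P"
  obtains S where "finite S" "P = convex_cone hull S"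
proof -
  have "polytope (cbox (-One) One \<inter> P)"
    by (intro polytope_Int_polyhedron polytope_interval assms)
  then obtain S where S: "finite S" "cbox (-One) One \<inter> P = convex hull S"
    unfolding polytope_def by auto
  have "convex_cone hull S \<subseteq> P"
    using S(2) assms(2) by (metis hull_minimal hull_subset le_inf_iff)
  moreover have "P \<subseteq> convex_cone hull S"
  proof
    fix x assume "x \<in> P"
    \<comment> \<open>This factor brings \<open>x\<close> into the unit ball, hence into the cube;
      the summand 1 covers \<open>x = 0\<close>.\<close>
    define t where "t = 1 / (norm x + 1)"
    have t: "t > 0" by (simp add: t_def add_nonneg_pos)
    have nt: "t * norm x \<le> 1" by (simp add: t_def divide_simps add_nonneg_pos)
    have "t *\<^sub>R x \<in> cbox (-One) One"
    proof (clarsimp simp: mem_box)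
      fix i :: 'a assume i: "i \<in> Basis"
      have "\<bar>t * (x \<bullet> i)\<bar> \<le> 1"
        using Basis_le_norm[OF i, of "t *\<^sub>R x"] nt t by simp
      then show "- 1 \<le> t * (x \<bullet> i) \<and> t * (x \<bullet> i) \<le> 1" by linarith
    qed
    moreover have "t *\<^sub>R x \<in> P"
      using convex_cone_scaleR[OF assms(2)] \<open>x \<in> P\<close> t by simp
    ultimately have "t *\<^sub>R x \<in> convex_cone hull S"
      using S(2) convex_hull_subset_convex_cone_hull by blast
    then have "inverse t *\<^sub>R (t *\<^sub>R x) \<in> convex_cone hull S"
      using t by (intro convex_cone_hull_mul[of _ _ "inverse t"]) auto
    then show "x \<in> convex_cone hull S" using t by simp
  qed
  ultimately show ?thesis using S(1) that by blast
qed

text \<open>Only the halfspaces whose boundary contains \<open>x\<close> are felt near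
  \<open>x\<close>; with right-hand side 0 they define \<open>T\<close>. The inclusion into
  \<open>T\<close> needs no bound on \<open>d\<close>, and this is what later yields global
  subgradient inequalities.\<close>

lemma polyhedron_locally_cone:
  fixes P :: "'a::euclidean_space set"
  assumes "polyhedron P" "x \<in> P"
  obtains T e where "polyhedron T" "convex_cone T" "e > 0"
    "\<And>d. x + d \<in> P \<Longrightarrow> d \<in> T"
    "\<And>d. norm d < e \<Longrightarrow> d \<in> T \<Longrightarrow> x + d \<in> P"
proof -
  obtain F where F: "finite F" "P = \<Inter>F" 
    and "\<forall>h\<in>F. \<exists>a b. a \<noteq> 0 \<and> h = {x. a \<bullet> x \<le> b}"
    using assms(1) unfolding polyhedron_def by auto
  then obtain a b where ab: "\<And>h. h \<in> F \<Longrightarrow> a h \<noteq> 0 \<and> h = {x. a h \<bullet> x \<le> b h}" by metis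
  define A where "A = {h \<in> F. a h \<bullet> x = b h}"
  define T where "T = (\<Inter>h\<in>A. {d. a h \<bullet> d \<le> 0})"
  have le: "a h \<bullet> x \<le> b h" if "h \<in> F" for h using that assms(2) F ab by blast
  have "finite A" using F by (simp add: A_def)
  have 1: "polyhedron T" unfolding T_def
    using \<open>finite A\<close> by (intro polyhedron_Inter) (auto simp: polyhedron_halfspace_le)
  have 2: "convex_cone T" unfolding T_def
    by (rule convex_cone_Inter) (auto simp: convex_cone_halfspace_le)
  \<comment> \<open>The inactive constraints hold strictly at \<open>x\<close>, and finitely many
    strict inequalities persist on a common ball.\<close>
  have "\<exists>e>0. \<forall>h\<in>F - A. \<forall>d. norm d < e \<longrightarrow> x + d \<in> h"
  proof -
    have "\<exists>e>0. ball x e \<subseteq> (\<Inter>h\<in>F - A. {y. a h \<bullet> y < b h})"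
    proof (rule openE)
      show "open (\<Inter>h\<in>F - A. {y. a h \<bullet> y < b h})"
        using F by (intro open_INT) (auto simp: open_halfspace_lt)
      show "x \<in> (\<Inter>h\<in>F - A. {y. a h \<bullet> y < b h})"
        using le by (force simp: A_def)
    qed auto
    then obtain e where "e > 0" and e: "ball x e \<subseteq> (\<Inter>h\<in>F - A. {y. a h \<bullet> y < b h})" by auto
    have "x + d \<in> h" if h: "h \<in> F - A" and "norm d < e" for h d
    proof -
      have "x + d \<in> ball x e" using that by (simp add: dist_norm)
      then have "a h \<bullet> (x + d) < b h" using e h by blast
      then have "x + d \<in> {y. a h \<bullet> y \<le> b h}" by simp
      then show ?thesis using h ab by blast
    qed
    then show ?thesis using \<open>e > 0\<close> by blast
  qed
  then obtain e where e: "e > 0" "\<And>h d. h \<in> F - A \<Longrightarrow> norm d < e \<Longrightarrow> x + d \<in> h" by blast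
  have act: "x + d \<in> h \<longleftrightarrow> a h \<bullet> d \<le> 0" if "h \<in> A" for h d
  proof -
    have "x + d \<in> h \<longleftrightarrow> x + d \<in> {y. a h \<bullet> y \<le> b h}"
      using ab that unfolding A_def by blast
    then show ?thesis using that by (simp add: A_def inner_add_right)
  qed
  show ?thesis
  proof (rule that[OF 1 2 e(1)])
    show "d \<in> T" if "x + d \<in> P" for d
      using that act F unfolding T_def by (force simp: A_def)
    show "x + d \<in> P" if "norm d < e" "d \<in> T" for d
      unfolding F
    proof
      fix h assume "h \<in> F"
      show "x + d \<in> h"
      proof (cases "h \<in> A")
        case True
        then show ?thesis using act that(2) by (auto simp: T_def)
      qed (use e that(1) \<open>h \<in> F\<close> in blast)
    qed
  qed
qed

lemma polyhedron_linear_vimage: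
  fixes f :: "'a::euclidean_space \<Rightarrow> 'b::euclidean_space"
  assumes "linear f" "polyhedron P"
  shows "polyhedron (f -` P)"
proof -
  obtain F where F: "finite F" "P = \<Inter>F" "\<forall>h\<in>F. \<exists>a b. a \<noteq> 0 \<and> h = {x. a \<bullet> x \<le> b}"
    using assms(2) unfolding polyhedron_def by auto
  have "polyhedron (f -` h)" if "h \<in> F" for h
  proof -
    from F(3) that obtain a b where "a \<noteq> 0 \<and> h = {x. a \<bullet> x \<le> b}" by meson
    \<comment> \<open>The new normal \<open>adjoint f a\<close> may be 0; the set is then everything
      or empty, which is still a polyhedron.\<close>
    then have "f -` h = {x. adjoint f a \<bullet> x \<le> b}"
      using adjoint_clauses(2)[OF assms(1)] by auto
    then show ?thesis by (simp only: polyhedron_halfspace_le)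
  qed
  moreover have "f -` P = \<Inter>((\<lambda>h. f -` h) ` F)" using F(2) by auto
  ultimately show ?thesis
    using F(1) by (simp only:) (intro polyhedron_Inter finite_imageI, auto)
qed

lemma convex_cone_linear_vimage:
  assumes "linear f" "convex_cone P"
  shows "convex_cone (f -` P)"
  unfolding convex_cone_iff
proof (intro conjI ballI allI impI)
  show "0 \<in> f -` P" using assms by (simp add: linear_0 convex_cone_contains_0)
  show "x + y \<in> f -` P" if "x \<in> f -` P" "y \<in> f -` P" for x y
    using that convex_cone_add[OF assms(2)] by (simp add: linear_add[OF assms(1)])
  show "c *\<^sub>R x \<in> f -` P" if "x \<in> f -` P" "0 \<le> c" for x c
    using that convex_cone_scaleR[OF assms(2)] by (simp add: linear_scale[OF assms(1)])
qed

section \<open>Linear functionals on finitely generated cones\<close>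

lemma convex_cone_hull_inner_nonpos:
  assumes "x \<in> convex_cone hull S" "\<And>s. s \<in> S \<Longrightarrow> v \<bullet> s \<le> 0"
  shows "v \<bullet> x \<le> 0"
proof -
  have "convex_cone hull S \<subseteq> {x. v \<bullet> x \<le> 0}"
    by (rule hull_minimal) (use assms(2) in \<open>auto simp: convex_cone_halfspace_le\<close>)
  then show ?thesis using assms(1) by blast
qed

lemma convex_cone_hull_inner_eq_0:
  assumes "x \<in> convex_cone hull S" "\<And>s. s \<in> S \<Longrightarrow> v \<bullet> s = 0"
  shows "v \<bullet> x = 0"
proof (rule order_antisym)
  show "v \<bullet> x \<le> 0" using assms by (intro convex_cone_hull_inner_nonpos[OF assms(1)]) simp
  have "- v \<bullet> x \<le> 0" using assms by (intro convex_cone_hull_inner_nonpos[OF assms(1)]) simp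
  then show "0 \<le> v \<bullet> x" by simp
qed

text \<open>A nonnegative combination of nonpositive numbers vanishes only if every negative one has
  weight 0, so generators with \<open>v \<bullet> s < 0\<close> cannot contribute to
  \<open>x\<close>.\<close>

lemma convex_cone_hull_exposed_face:
  assumes x: "x \<in> convex_cone hull S" "v \<bullet> x = 0" and S: "\<And>s. s \<in> S \<Longrightarrow> v \<bullet> s \<le> 0"
  shows "x \<in> convex_cone hull {s \<in> S. v \<bullet> s = 0}"
proof -
  let ?H = "convex_cone hull {s \<in> S. v \<bullet> s = 0}"
  \<comment> \<open>Minimality of the hull replaces explicit coefficients: the claim, joined with
    the sign condition, describes a convex cone containing \<open>S\<close>. The sign condition
    makes the implication stable under sums.\<close>
  have "convex_cone hull S \<subseteq> {x. v \<bullet> x \<le> 0 \<and> (v \<bullet> x = 0 \<longrightarrow> x \<in> ?H)}" (is "_ \<subseteq> ?C")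
  proof (rule hull_minimal)
    show "S \<subseteq> ?C" using S by (auto intro: hull_inc)
    have "y + z \<in> ?C" if y: "y \<in> ?C" and z: "z \<in> ?C" for y z
    proof -
      have "v \<bullet> y \<le> 0" "v \<bullet> z \<le> 0" using y z by simp_all
      then have "v \<bullet> (y + z) \<le> 0" "v \<bullet> (y + z) = 0 \<Longrightarrow> v \<bullet> y = 0 \<and> v \<bullet> z = 0"
        by (auto simp: inner_add_right)
      then show ?thesis using y z convex_cone_hull_add by blast
    qed
    moreover have "c *\<^sub>R y \<in> ?C" if "y \<in> ?C" "c \<ge> 0" for y and c :: real
      using that convex_cone_hull_mul[of y _ c]
      by (cases "c = 0") (auto simp: mult_nonneg_nonpos convex_cone_hull_contains_0)
    ultimately show "convex_cone ?C"
      by (intro convex_cone_iff[THEN iffD2]) (simp add: convex_cone_hull_contains_0)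
  qed
  then show ?thesis using x by blast
qed

text \<open>A difference of closed cones can fail to be closed. Here it is again finitely generated,
  by \<open>A\<close> and the negatives of \<open>B\<close>, and therefore closed.\<close>

lemma closed_convex_cone_hull_differences:
  fixes A B :: "'a::euclidean_space set"
  assumes "finite A" "finite B"
  shows "closed {a - b | a b. a \<in> convex_cone hull A \<and> b \<in> convex_cone hull B}"
proof -
  have neg: "convex_cone hull (uminus ` B) = uminus ` (convex_cone hull B)"
    by (simp add: convex_cone_hull_linear_image module_hom_uminus)
  have "{a - b | a b. a \<in> convex_cone hull A \<and> b \<in> convex_cone hull B}
      = convex_cone hull (A \<union> uminus ` B)"
    unfolding convex_cone_hull_Un neg by (force simp: image_iff)
  then show ?thesis using assms by (simp add: closed_convex_cone_hull)
qed

text \<open>With \<open>S\<close> generating a cone and \<open>A\<close> a subset of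
  \<open>S\<close>, these are the polar vectors orthogonal to the part generated by
  \<open>A\<close>. They form the second factors of the pieces of the graph of a normal cone
  map.\<close>

lemma polar_annihilator_polyhedral_cone:
  fixes S A :: "'a::euclidean_space set"
  assumes "finite S" "finite A"
  shows "polyhedron {v. (\<forall>s\<in>S. v \<bullet> s \<le> 0) \<and> (\<forall>a\<in>A. v \<bullet> a = 0)}"
    and "convex_cone {v. (\<forall>s\<in>S. v \<bullet> s \<le> 0) \<and> (\<forall>a\<in>A. v \<bullet> a = 0)}"
proof -
  have "{v. (\<forall>s\<in>S. v \<bullet> s \<le> 0) \<and> (\<forall>a\<in>A. v \<bullet> a = 0)}
      = \<Inter>((\<lambda>s. {v. s \<bullet> v \<le> 0}) ` S) \<inter> \<Inter>((\<lambda>s. {v. s \<bullet> v = 0}) ` A)"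
    by (auto simp: inner_commute)
  moreover have "polyhedron \<dots>"
    using assms by (intro polyhedron_Int polyhedron_Inter)
      (auto simp: polyhedron_halfspace_le polyhedron_hyperplane)
  ultimately show "polyhedron {v. (\<forall>s\<in>S. v \<bullet> s \<le> 0) \<and> (\<forall>a\<in>A. v \<bullet> a = 0)}" by simp
qed (auto simp: convex_cone_iff inner_add_left mult_nonneg_nonpos add_nonpos_nonpos)

subsection \<open>Set limits at points where a set agrees with a cone\<close>

lemma eventually_strict_filter:
  fixes p :: "'a::metric_space"
  shows "eventually P (strict_filter G p) \<longleftrightarrow>
    (\<exists>d>0. \<forall>t q. 0 < t \<and> t < d \<and> dist q p < d \<and> q \<in> G \<longrightarrow> P (t, q))" (is "_ = ?R")
proof
  assume "eventually P (strict_filter G p)"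
  then obtain Pf Pg where "eventually Pf (at_right 0)" "eventually Pg (inf (nhds p) (principal G))"
    and P: "\<And>x y. Pf x \<Longrightarrow> Pg y \<Longrightarrow> P (x, y)"
    unfolding strict_filter_def eventually_prod_filter by blast
  moreover from this obtain b where "b > 0" "\<And>t. 0 < t \<Longrightarrow> t < b \<Longrightarrow> Pf t"
    unfolding eventually_at_right_field by blast
  moreover from calculation obtain d where "d > 0" "\<And>q. dist q p < d \<Longrightarrow> q \<in> G \<Longrightarrow> Pg q"
    unfolding eventually_inf_principal eventually_nhds_metric by blast
  ultimately show ?R by (intro exI[of _ "min b d"]) auto
next
  assume ?R
  then obtain d where d: "d > 0" "\<And>t q. 0 < t \<and> t < d \<and> dist q p < d \<and> q \<in> G \<Longrightarrow> P (t, q)" by blast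
  show "eventually P (strict_filter G p)"
    unfolding strict_filter_def eventually_prod_filter
  proof (intro exI conjI)
    show "eventually (\<lambda>t. 0 < t \<and> t < d) (at_right (0::real))"
      unfolding eventually_at_right_field using d(1) by blast
    show "eventually (\<lambda>q. dist q p < d \<and> q \<in> G) (inf (nhds p) (principal G))"
      unfolding eventually_inf_principal eventually_nhds_metric using d(1) by blast
  qed (use d in auto)
qed

lemma frequently_strict_filter:
  fixes p :: "'a::metric_space"
  shows "frequently P (strict_filter G p) \<longleftrightarrow>
    (\<forall>d>0. \<exists>t q. 0 < t \<and> t < d \<and> dist q p < d \<and> q \<in> G \<and> P (t, q))"
  unfolding frequently_def eventually_strict_filter by blast

lemma strict_filter_neq_bot:
  fixes p :: "'a::metric_space"
  assumes "p \<in> G"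
  shows "strict_filter G p \<noteq> bot"
  unfolding eventually_False[symmetric] eventually_strict_filter
  using assms by (metis dense dist_self)

lemma inner_limit_subset_outer_limit:
  "F \<noteq> bot \<Longrightarrow> inner_limit F A \<subseteq> outer_limit F A"
  unfolding inner_limit_def outer_limit_def by (auto intro: eventually_frequently)

lemma frequently_at_right_zero:
  "frequently P (at_right (0::real)) \<longleftrightarrow> (\<forall>d>0. \<exists>t. 0 < t \<and> t < d \<and> P t)"
  unfolding frequently_def eventually_at_right_field by (metis not_le)

text \<open>Exact equality of \<open>G - x\<close> and \<open>M\<close> on a ball around 0. This is
  stronger than first-order approximation and can be transported to nearby base points.\<close>

definition agrees_near :: "'a::real_normed_vector set \<Rightarrow> 'a \<Rightarrow> 'a set \<Rightarrow> bool" where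
  "agrees_near G x M \<longleftrightarrow> (\<exists>e>0. \<forall>d. norm d < e \<longrightarrow> (x + d \<in> G \<longleftrightarrow> d \<in> M))"

lemma exists_small_multiplier:
  fixes w :: "'a::real_normed_vector"
  assumes "e > 0"
  obtains d :: real where "d > 0" "\<And>t. 0 < t \<Longrightarrow> t < d \<Longrightarrow> norm (t *\<^sub>R w) < e"
proof (rule that)
  show "e / (norm w + 1) > 0" using assms by (simp add: add_nonneg_pos)
  show "norm (t *\<^sub>R w) < e" if "0 < t" "t < e / (norm w + 1)" for t
  proof -
    have "t * (norm w + 1) < e"
      using that by (simp add: pos_less_divide_eq add_nonneg_pos)
    then show ?thesis using that by (simp add: algebra_simps)
  qed
qed

text \<open>For small \<open>t\<close>, quotients close to \<open>v\<close> come from points of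
  \<open>G\<close> near \<open>x\<close>, so conicity puts them into \<open>M\<close> and closedness
  passes to the limit. Conversely a short multiple of any \<open>v\<close> in \<open>M\<close> leads
  into \<open>G\<close>.\<close>

lemma tangent_cone_agrees_near:
  fixes x :: "'a::real_normed_vector"
  assumes G: "agrees_near G x M" and M: "conic M" "closed M"
  shows "tangent_cone G x = M"
proof -
  obtain e where "e > 0" and e: "\<And>d. norm d < e \<Longrightarrow> x + d \<in> G \<longleftrightarrow> d \<in> M"
    using G unfolding agrees_near_def by blast
  show ?thesis
  proof (intro equalityI subsetI)
    fix v assume v: "v \<in> tangent_cone G x"
    have "\<exists>u\<in>M. dist u v < r" if "r > 0" for r
    proof -
      \<comment> \<open>Capping the tolerance at 1 bounds the quotient \<open>u\<close> by
        \<open>norm v + 1\<close>; the choice of \<open>d\<close> below then gives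
        \<open>norm (t *\<^sub>R u) < e\<close>.\<close>
      define r' where "r' = min r 1"
      have r': "r' > 0" "r' \<le> r" "r' \<le> 1" using that by (auto simp: r'_def)
      define d where "d = e / (norm v + 1)"
      have "d > 0" using \<open>e > 0\<close> by (simp add: d_def add_nonneg_pos)
      then obtain t y where t: "0 < t" "t < d" and y: "y \<in> G" "dist ((1 / t) *\<^sub>R (y - x)) v < r'"
        using v r'(1) unfolding tangent_cone_def outer_limit_def frequently_at_right_zero by blast
      define u where "u = (1 / t) *\<^sub>R (y - x)"
      have "norm u \<le> norm v + 1"
        using y(2) r' norm_triangle_ineq2[of u v] unfolding u_def[symmetric] dist_norm by linarith
      then have "norm (t *\<^sub>R u) \<le> t * (norm v + 1)" using t by simp
      also have "\<dots> < e" using t by (simp add: d_def pos_less_divide_eq add_nonneg_pos)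
      finally have "t *\<^sub>R u \<in> M"
        using e[of "t *\<^sub>R u"] y(1) t by (simp add: u_def)
      then have "(1 / t) *\<^sub>R (t *\<^sub>R u) \<in> M" using t M(1) conicD[of M "t *\<^sub>R u" "1 / t"] by auto
      then have "u \<in> M" using t by simp
      then show ?thesis using y(2) r' u_def by force
    qed
    then show "v \<in> M" using M(2) closure_approachable closure_closed by blast
  next
    fix v assume "v \<in> M"
    obtain d where "d > 0" and d: "\<And>t. 0 < t \<Longrightarrow> t < d \<Longrightarrow> norm (t *\<^sub>R v) < e"
      using exists_small_multiplier[OF \<open>e > 0\<close>] by blast
    have "\<exists>t. 0 < t \<and> t < d' \<and> (\<exists>u\<in>(\<lambda>y. (1 / t) *\<^sub>R (y - x)) ` G. dist u v < r)"
      if "d' > 0" "r > 0" for d' r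
    proof -
      define t where "t = min d d' / 2"
      have t: "0 < t" "t < min d d'" using \<open>d > 0\<close> that by (auto simp: t_def)
      have "x + t *\<^sub>R v \<in> G" using e d t \<open>v \<in> M\<close> M(1) conicD[of M v t] by auto
      then have "(1 / t) *\<^sub>R (x + t *\<^sub>R v - x) \<in> (\<lambda>y. (1 / t) *\<^sub>R (y - x)) ` G" by blast
      then have "v \<in> (\<lambda>y. (1 / t) *\<^sub>R (y - x)) ` G" using t by simp
      then show ?thesis using t that by (metis dist_self min_less_iff_conj)
    qed
    then show "v \<in> tangent_cone G x"
      unfolding tangent_cone_def outer_limit_def frequently_at_right_zero by blast
  qed
qed

text \<open>Now the base point \<open>q\<close> moves in \<open>x + M\<close> too, so a quotient is
  a difference of two elements of \<open>M\<close>. Conversely \<open>a - b\<close> is attained with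
  base point \<open>x + t *\<^sub>R b\<close> and end point
  \<open>x + t *\<^sub>R a\<close>.\<close>

lemma strict_outer_limit_agrees_near:
  fixes x :: "'a::real_normed_vector"
  assumes G: "agrees_near G x M" and M: "conic M" 
    and cl: "closed {a - b | a b. a \<in> M \<and> b \<in> M}"
  shows "outer_limit (strict_filter G x) (strict_quot G) = {a - b | a b. a \<in> M \<and> b \<in> M}"
    (is "?L = ?D")
proof -
  obtain e where "e > 0" and e: "\<And>d. norm d < e \<Longrightarrow> x + d \<in> G \<longleftrightarrow> d \<in> M"
    using G unfolding agrees_near_def by blast
  show ?thesis
  proof (intro equalityI subsetI)
    fix v assume v: "v \<in> ?L"
    have "\<exists>u\<in>?D. dist u v < r" if "r > 0" for r
    proof -
      define r' where "r' = min r 1"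
      have r': "r' > 0" "r' \<le> r" "r' \<le> 1" using that by (auto simp: r'_def)
      \<comment> \<open>Half of the radius \<open>e\<close> is reserved for the displacement of
        \<open>q\<close> from \<open>x\<close>, the other half for the step
        \<open>t *\<^sub>R u\<close>.\<close>
      define d where "d = min (e / 2) (e / 2 / (norm v + 1))"
      have "d > 0" using \<open>e > 0\<close> by (simp add: d_def add_nonneg_pos)
      then obtain t q y where t: "0 < t" "t < d" and q: "q \<in> G" "dist q x < d"
        and y: "y \<in> G" "dist ((1 / t) *\<^sub>R (y - q)) v < r'"
        using v r'(1) unfolding outer_limit_def frequently_strict_filter strict_quot_def
        by (simp add: Bex_def image_iff) (metis that)
      define u where "u = (1 / t) *\<^sub>R (y - q)"
      have yq: "y = q + t *\<^sub>R u" using t by (simp add: u_def)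
      have "norm u \<le> norm v + 1"
        using y(2) r' norm_triangle_ineq2[of u v] unfolding u_def[symmetric] dist_norm by linarith
      then have "norm (t *\<^sub>R u) \<le> t * (norm v + 1)" using t by simp
      also have "\<dots> < e / 2"
      proof -
        have "t < e / 2 / (norm v + 1)" using t(2) by (simp add: d_def)
        then show ?thesis by (subst (asm) pos_less_divide_eq) (auto simp: add_nonneg_pos)
      qed
      finally have "norm (t *\<^sub>R u) < e / 2" .
      moreover have nq: "norm (q - x) < e / 2" using q(2) by (simp add: d_def dist_norm)
      ultimately have ny: "norm (y - x) < e"
        using norm_triangle_ineq[of "q - x" "t *\<^sub>R u"] yq by (simp add: algebra_simps)
      have "q - x \<in> M" "y - x \<in> M" using e[of "q - x"] e[of "y - x"] nq ny q y \<open>e > 0\<close> by auto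
      then have "(1/t) *\<^sub>R (y - x) \<in> M" "(1/t) *\<^sub>R (q - x) \<in> M" using t M conicD[of M] by auto
      moreover have "u = (1/t) *\<^sub>R (y - x) - (1/t) *\<^sub>R (q - x)"
        by (simp add: u_def scaleR_diff_right)
      ultimately have "u \<in> ?D" by blast
      then show ?thesis using y(2) r' u_def by force
    qed
    then show "v \<in> ?D" using cl closure_approachable closure_closed by blast
  next
    fix v assume "v \<in> ?D"
    then obtain a b where ab: "v = a - b" "a \<in> M" "b \<in> M" by blast
    have "\<exists>t q. 0 < t \<and> t < d \<and> dist q x < d \<and> q \<in> G \<and> (\<exists>u\<in>strict_quot G (t, q). dist u v < r)"
      if "d > 0" "r > 0" for d r
    proof -
      have m: "min e d > 0" using \<open>e > 0\<close> that by simp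
      obtain d1 where "d1 > 0" and d1: "\<And>t. 0 < t \<Longrightarrow> t < d1 \<Longrightarrow> norm (t *\<^sub>R a) < min e d"
        using exists_small_multiplier[OF m] by blast
      obtain d2 where "d2 > 0" and d2: "\<And>t. 0 < t \<Longrightarrow> t < d2 \<Longrightarrow> norm (t *\<^sub>R b) < min e d"
        using exists_small_multiplier[OF m] by blast
      define t where "t = min d (min d1 d2) / 2"
      have t: "0 < t" "t < min d (min d1 d2)"
        using \<open>d1 > 0\<close> \<open>d2 > 0\<close> that by (auto simp: t_def)
      have "x + t *\<^sub>R a \<in> G" "x + t *\<^sub>R b \<in> G" "dist (x + t *\<^sub>R b) x < d"
        using e[of "t *\<^sub>R a"] e[of "t *\<^sub>R b"] d1[of t] d2[of t] t ab M conicD[of M _ t]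
        by (auto simp: dist_norm)
      moreover have "v = (1 / t) *\<^sub>R ((x + t *\<^sub>R a) - (x + t *\<^sub>R b))"
        using t ab by (simp flip: scaleR_diff_right)
      ultimately have "v \<in> strict_quot G (t, x + t *\<^sub>R b)"
        unfolding strict_quot_def split using \<open>x + t *\<^sub>R a \<in> G\<close> by blast
      then show ?thesis
        using t \<open>dist (x + t *\<^sub>R b) x < d\<close> \<open>x + t *\<^sub>R b \<in> G\<close> \<open>r > 0\<close>
        by (metis dist_self min_less_iff_conj)
    qed
    then show "v \<in> ?L"
      unfolding outer_limit_def frequently_strict_filter by blast
  qed
qed

text \<open>From any \<open>q\<close> in \<open>x + M\<close> the step \<open>t *\<^sub>R v\<close>
  stays in \<open>x + M\<close>, so \<open>v\<close> itself, without approximation, is a quotient at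
  every nearby base point.\<close>

lemma strict_inner_limit_subspace:
  fixes x :: "'a::real_normed_vector"
  assumes G: "agrees_near G x M" and M: "subspace M"
  shows "M \<subseteq> inner_limit (strict_filter G x) (strict_quot G)"
proof
  fix v assume "v \<in> M"
  obtain e where "e > 0" and e: "\<And>d. norm d < e \<Longrightarrow> x + d \<in> G \<longleftrightarrow> d \<in> M"
    using G unfolding agrees_near_def by blast
  obtain d where "d > 0" and d: "\<And>t. 0 < t \<Longrightarrow> t < d \<Longrightarrow> norm (t *\<^sub>R v) < e / 2"
    using exists_small_multiplier[of "e / 2"] \<open>e > 0\<close> by auto
  have *: "v \<in> strict_quot G (t, q)" if "0 < t" "t < min d (e / 2)" "dist q x < min d (e / 2)" "q \<in> G" for t q
  proof -
    have q: "norm (q - x) < e / 2" using that by (simp add: dist_norm)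
    then have "q - x \<in> M" using e[of "q - x"] that \<open>e > 0\<close> by auto
    then have "q - x + t *\<^sub>R v \<in> M"
      using M \<open>v \<in> M\<close> by (simp add: subspace_add subspace_scale)
    moreover have "norm (q - x + t *\<^sub>R v) < e"
      using q d[of t] that norm_triangle_ineq[of "q - x" "t *\<^sub>R v"] by auto
    ultimately have "q + t *\<^sub>R v \<in> G" using e[of "q - x + t *\<^sub>R v"] by (simp add: algebra_simps)
    then have "(1 / t) *\<^sub>R (q + t *\<^sub>R v - q) \<in> strict_quot G (t, q)"
      unfolding strict_quot_def by blast
    then show ?thesis using that by simp
  qed
  have "eventually (\<lambda>p. v \<in> strict_quot G p) (strict_filter G x)"
    unfolding eventually_strict_filter
    using * \<open>d > 0\<close> \<open>e > 0\<close> by (intro exI[of _ "min d (e / 2)"]) auto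
  then show "v \<in> inner_limit (strict_filter G x) (strict_quot G)"
    unfolding inner_limit_def by (auto elim!: eventually_mono intro: bexI[of _ v])
qed

text \<open>A subspace is invariant under translation by its element \<open>y - x\<close>, so the
  same \<open>M\<close> describes \<open>G\<close> around every nearby point of
  \<open>G\<close>.\<close>

lemma agrees_near_subspace_shift:
  assumes "agrees_near G x M" "subspace M"
  obtains U where "open U" "x \<in> U" "\<And>y. y \<in> U \<Longrightarrow> y \<in> G \<Longrightarrow> agrees_near G y M"
proof -
  obtain e where "e > 0" and e: "\<And>d. norm d < e \<Longrightarrow> x + d \<in> G \<longleftrightarrow> d \<in> M"
    using assms unfolding agrees_near_def by blast
  have "agrees_near G y M" if "y \<in> ball x (e / 2)" "y \<in> G" for y
    unfolding agrees_near_def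
  proof (intro exI conjI allI impI)
    show "e / 2 > 0" using \<open>e > 0\<close> by simp
    fix d :: 'a assume d: "norm d < e / 2"
    have y: "norm (y - x) < e / 2" using that by (simp add: dist_norm norm_minus_commute)
    then have yM: "y - x \<in> M" using e[of "y - x"] that \<open>e > 0\<close> by auto
    have "norm (y - x + d) < e" using y d norm_triangle_ineq[of "y - x" d] by auto
    then have "y + d \<in> G \<longleftrightarrow> y - x + d \<in> M" using e[of "y - x + d"] by (simp add: algebra_simps)
    also have "\<dots> \<longleftrightarrow> d \<in> M"
      using yM assms(2) by (metis add_diff_cancel_left' subspace_add subspace_diff)
    finally show "y + d \<in> G \<longleftrightarrow> d \<in> M" .
  qed
  then show ?thesis using that[of "ball x (e / 2)"] \<open>e > 0\<close> by auto
qed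

subsection \<open>The graph of the normal cone map of a polyhedral cone\<close>

text \<open>On a cone the normal inequality splits into polarity, by testing at
  \<open>k + u\<close>, and complementarity, by testing at 0.\<close>

lemma in_gph_normal_cone_map:
  assumes "convex_cone K"
  shows "(u, v) \<in> gph (normal_cone_map K) \<longleftrightarrow> u \<in> K \<and> (\<forall>k\<in>K. v \<bullet> k \<le> 0) \<and> v \<bullet> u = 0"
    (is "?L \<longleftrightarrow> ?R")
proof
  assume ?L
  then have u: "u \<in> K" and v: "\<And>k. k \<in> K \<Longrightarrow> v \<bullet> (k - u) \<le> 0"
    by (auto simp: gph_def normal_cone_map_def)
  have "v \<bullet> k \<le> 0" if "k \<in> K" for k
    using v[OF convex_cone_add[OF assms that u]] by simp
  moreover have "v \<bullet> u \<ge> 0"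
    using v[OF convex_cone_contains_0[OF assms]] by simp
  ultimately show ?R using u by force
qed (auto simp: gph_def normal_cone_map_def inner_diff_right)

lemma conic_gph_normal_cone_map:
  assumes "convex_cone K"
  shows "conic (gph (normal_cone_map K))"
  unfolding conic_def
proof (intro allI impI)
  fix p :: "(real^'a) \<times> (real^'a)" and c :: real
  assume "p \<in> gph (normal_cone_map K)" "0 \<le> c"
  then show "c *\<^sub>R p \<in> gph (normal_cone_map K)"
    using convex_cone_scaleR[OF assms, of c "fst p"]
    by (cases p) (simp add: in_gph_normal_cone_map[OF assms] mult_nonneg_nonpos)
qed

lemma closed_gph_normal_cone_map:
  assumes "convex_cone K" "closed K"
  shows "closed (gph (normal_cone_map K))"
proof -
  have "gph (normal_cone_map K) = (K \<times> (\<Inter>k\<in>K. {v. k \<bullet> v \<le> 0})) \<inter> {p. snd p \<bullet> fst p = 0}"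
    using assms(1) by (auto simp: in_gph_normal_cone_map inner_commute)
  moreover have "closed (K \<times> (\<Inter>k\<in>K. {v. k \<bullet> v \<le> 0}))"
    using assms(2) by (intro closed_Times closed_INT) (auto simp: closed_halfspace_le)
  moreover have "closed {p :: (real^'a) \<times> (real^'a). snd p \<bullet> fst p = 0}"
    by (intro closed_Collect_eq continuous_intros)
  ultimately show ?thesis by (simp add: closed_Int)
qed

text \<open>For a subspace the graph is the product of \<open>K\<close> with its orthogonal
  complement.\<close>

lemma subspace_gph_normal_cone_map:
  assumes "subspace K"
  shows "subspace (gph (normal_cone_map K))"
proof -
  have K: "convex_cone K" using assms by (rule subspace_imp_convex_cone)
  have orth: "v \<bullet> k = 0" if "\<forall>k\<in>K. v \<bullet> k \<le> 0" "k \<in> K" for k v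
    using that subspace_neg[OF assms, of k] by (metis inner_minus_right neg_le_0_iff_le order_antisym)
  have "gph (normal_cone_map K) = K \<times> {v. \<forall>k\<in>K. v \<bullet> k = 0}"
    using orth by (auto simp: in_gph_normal_cone_map[OF K])
  moreover have "subspace {v. \<forall>k\<in>K. v \<bullet> k = 0}"
    by (auto simp: subspace_def inner_add_left)
  ultimately show ?thesis using assms by (simp add: subspace_Times)
qed

text \<open>The graph is a finite union of products of finitely generated cones, one for each set
  \<open>A\<close> of generators of \<open>K\<close>. Its differences are thus a finite union of
  products of differences of such cones, each closed.\<close>

lemma closed_gph_normal_cone_map_differences:
  fixes K :: "(real^'m) set"
  assumes "polyhedron K" "convex_cone K"
  shows "closed {a - b | a b. a \<in> gph (normal_cone_map K) \<and> b \<in> gph (normal_cone_map K)}"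
    (is "closed ?D")
proof -
  obtain S where S: "finite S" "K = convex_cone hull S"
    using polyhedral_cone_finitely_generated[OF assms] by blast
  have "\<forall>A\<in>Pow S. \<exists>B. finite B \<and>
      {v. (\<forall>s\<in>S. v \<bullet> s \<le> 0) \<and> (\<forall>a\<in>A. v \<bullet> a = 0)} = convex_cone hull B"
  proof
    fix A assume "A \<in> Pow S"
    then have "finite A" using S(1) finite_subset by blast
    show "\<exists>B. finite B \<and>
        {v. (\<forall>s\<in>S. v \<bullet> s \<le> 0) \<and> (\<forall>a\<in>A. v \<bullet> a = 0)} = convex_cone hull B"
      by (rule polyhedral_cone_finitely_generated[OF polar_annihilator_polyhedral_cone[OF S(1) \<open>finite A\<close>]]) blast
  qed
  from bchoice[OF this] obtain B where finB: "\<And>A. A \<subseteq> S \<Longrightarrow> finite (B A)"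
    and B: "\<And>A. A \<subseteq> S \<Longrightarrow> {v. (\<forall>s\<in>S. v \<bullet> s \<le> 0) \<and> (\<forall>a\<in>A. v \<bullet> a = 0)} = convex_cone hull (B A)"
    by blast
  have M: "gph (normal_cone_map K) = (\<Union>A\<in>Pow S. (convex_cone hull A) \<times> (convex_cone hull (B A)))"
    (is "_ = ?U")
  proof (intro equalityI subrelI)
    fix u v assume "(u, v) \<in> gph (normal_cone_map K)"
    then have uv: "u \<in> convex_cone hull S" "v \<bullet> u = 0" "\<And>s. s \<in> S \<Longrightarrow> v \<bullet> s \<le> 0"
      using assms(2) S(2) by (auto simp: in_gph_normal_cone_map hull_inc)
    \<comment> \<open>The face of \<open>K\<close> exposed by \<open>v\<close> is generated by the
      generators orthogonal to \<open>v\<close>, and \<open>u\<close> lies in that face.\<close>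
    define A where "A = {s \<in> S. v \<bullet> s = 0}"
    have "A \<subseteq> S" by (auto simp: A_def)
    have "u \<in> convex_cone hull A"
      unfolding A_def using uv by (rule convex_cone_hull_exposed_face)
    moreover have "v \<in> convex_cone hull (B A)"
      using B[OF \<open>A \<subseteq> S\<close>] uv(3) by (auto simp: A_def)
    ultimately show "(u, v) \<in> ?U" using \<open>A \<subseteq> S\<close> by blast
  next
    fix u v assume "(u, v) \<in> ?U"
    then obtain A where A: "A \<subseteq> S" "u \<in> convex_cone hull A" "v \<in> convex_cone hull (B A)" by blast
    then have v: "\<And>s. s \<in> S \<Longrightarrow> v \<bullet> s \<le> 0" "\<And>a. a \<in> A \<Longrightarrow> v \<bullet> a = 0" using B[OF A(1)] by auto
    have "u \<in> K" using A hull_mono[OF A(1), of convex_cone] S(2) by blast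
    moreover have "\<forall>k\<in>K. v \<bullet> k \<le> 0" unfolding S(2) using v(1) convex_cone_hull_inner_nonpos by blast
    moreover have "v \<bullet> u = 0" using A(2) v(2) by (rule convex_cone_hull_inner_eq_0)
    ultimately show "(u, v) \<in> gph (normal_cone_map K)"
      by (simp add: in_gph_normal_cone_map[OF assms(2)])
  qed
  have "?D = (\<Union>A\<in>Pow S. \<Union>A'\<in>Pow S.
      {a - b | a b. a \<in> convex_cone hull A \<and> b \<in> convex_cone hull A'} \<times>
      {a - b | a b. a \<in> convex_cone hull (B A) \<and> b \<in> convex_cone hull (B A')})" (is "_ = ?V")
  proof (intro equalityI subsetI)
    fix p assume "p \<in> ?D"
    then obtain u v u' v' A A' where "p = (u, v) - (u', v')" "A \<subseteq> S" "A' \<subseteq> S"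
       "u \<in> convex_cone hull A" "v \<in> convex_cone hull (B A)" 
       "u' \<in> convex_cone hull A'" "v' \<in> convex_cone hull (B A')"
      unfolding M by blast
    then show "p \<in> ?V" by auto
  next
    fix p assume "p \<in> ?V"
    then obtain u v u' v' A A' where "p = (u - u', v - v')" "A \<subseteq> S" "A' \<subseteq> S"
       "u \<in> convex_cone hull A" "v \<in> convex_cone hull (B A)" 
       "u' \<in> convex_cone hull A'" "v' \<in> convex_cone hull (B A')"
      by blast
    then have "p = (u, v) - (u', v') \<and> (u, v) \<in> ?U \<and> (u', v') \<in> ?U" by auto
    then show "p \<in> ?D" unfolding M by blast
  qed
  moreover have "closed ?V"
    using S(1) finB
    by (intro closed_UN ballI closed_Times closed_convex_cone_hull_differences)
      (auto intro: finite_subset)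
  ultimately show ?thesis by simp
qed

subsection \<open>The subdifferential of a locally conical epigraph\<close>

text \<open>\<open>T\<close> is the epigraph seen from the point \<open>(z, c)\<close>:
  \<open>epi_in_T\<close> is global, \<open>T_in_epi\<close> only local. The finite generating set
  \<open>D\<close> is kept because it reduces subgradient conditions to finitely many
  inequalities.\<close>

locale local_epigraph_cone =
  fixes g :: "real^'m \<Rightarrow> ereal" and z :: "real^'m" and c :: real
    and T D :: "((real^'m) \<times> real) set" and e :: real
  assumes not_MInf: "\<And>y. g y \<noteq> -\<infinity>"
    and gz: "g z = ereal c"
    and finD: "finite D" and T: "T = convex_cone hull D"
    and e: "e > 0"
    and epi_in_T: "\<And>w a. g (z + w) \<le> ereal (c + a) \<Longrightarrow> (w, a) \<in> T"
    and T_in_epi: "\<And>w a. norm (w, a) < e \<Longrightarrow> (w, a) \<in> T \<Longrightarrow> g (z + w) \<le> ereal (c + a)"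
begin

lemma cone_T: "convex_cone T"
  unfolding T by (rule convex_cone_convex_cone_hull)

lemma polyhedron_T: "polyhedron T"
  unfolding T by (rule polyhedron_convex_cone_hull[OF finD])

lemma closed_T: "closed T"
  using polyhedron_T by (rule polyhedron_imp_closed)

lemma scale_T: "(w, a) \<in> T \<Longrightarrow> t \<ge> 0 \<Longrightarrow> (t *\<^sub>R w, t * a) \<in> T"
  using convex_cone_scaleR[OF cone_T, of t "(w, a)"] by simp

lemma vertical_in_T: "b \<ge> 0 \<Longrightarrow> (0, b) \<in> T"
  by (rule epi_in_T) (simp add: gz)

lemma upward_T: "(w, a) \<in> T \<Longrightarrow> a \<le> b \<Longrightarrow> (w, b) \<in> T"
  using convex_cone_add[OF cone_T, of "(w, a)" "(0, b - a)"] vertical_in_T by simp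

lemma real_value:
  assumes "g y \<le> ereal b"
  obtains r where "g y = ereal r" "r \<le> b"
  using assms not_MInf[of y] by (cases "g y") auto

text \<open>The inequality is positively homogeneous in \<open>(w, a)\<close>, so it suffices to
  test it on short vectors of \<open>T\<close>, which belong to the translated epigraph.\<close>

lemma subdiff_iff: "l \<in> subdiff g z \<longleftrightarrow> (\<forall>(w, a)\<in>T. l \<bullet> w \<le> a)"
proof
  assume l: "l \<in> subdiff g z"
  show "\<forall>(w, a)\<in>T. l \<bullet> w \<le> a"
  proof clarify
    fix w a assume wa: "(w, a) \<in> T"
    obtain d where "d > 0" and d: "\<And>t. 0 < t \<Longrightarrow> t < d \<Longrightarrow> norm (t *\<^sub>R (w, a)) < e"
      using exists_small_multiplier[OF e] by blast
    define t where "t = d / 2"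
    have t: "0 < t" "t < d" using \<open>d > 0\<close> by (auto simp: t_def)
    have "g (z + t *\<^sub>R w) \<le> ereal (c + t * a)"
      using T_in_epi[of "t *\<^sub>R w" "t * a"] d[OF t] scale_T[OF wa, of t] t by simp
    moreover have "ereal c + ereal (l \<bullet> (t *\<^sub>R w)) \<le> g (z + t *\<^sub>R w)"
      using l unfolding subdiff_def gz by (metis (mono_tags, lifting) add_diff_cancel_left' mem_Collect_eq)
    ultimately have "ereal c + ereal (l \<bullet> (t *\<^sub>R w)) \<le> ereal (c + t * a)" by (rule order_trans[rotated])
    then have "t * (l \<bullet> w) \<le> t * a" by simp
    then show "l \<bullet> w \<le> a" using t by simp
  qed
next
  assume l: "\<forall>(w, a)\<in>T. l \<bullet> w \<le> a"
  have "ereal c + ereal (l \<bullet> (y - z)) \<le> g y" for y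
  proof (cases "g y")
    case (real r)
    then have "(y - z, r - c) \<in> T" using epi_in_T[of "y - z" "r - c"] by simp
    then show ?thesis using l real by force
  qed (use not_MInf in auto)
  then show "l \<in> subdiff g z" by (simp add: subdiff_def gz)
qed

lemma convex_subdiff: "convex (subdiff g z)"
proof -
  have "subdiff g z = (\<Inter>p\<in>T. {l. fst p \<bullet> l \<le> snd p})"
    by (force simp: subdiff_iff inner_commute case_prod_beta)
  then show ?thesis by (auto intro!: convex_INT simp: convex_halfspace_le)
qed

text \<open>A subgradient bounds the subderivative below by \<open>l \<bullet> w\<close>. The bound
  is attained along the ray through \<open>(w, l \<bullet> w)\<close> if that vector lies in
  \<open>T\<close>; conversely, nearly minimal quotients give points of the closed set
  \<open>T\<close> converging to it.\<close>

lemma critical_cone_eq: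
  assumes l: "l \<in> subdiff g z"
  shows "critical_cone g z l = {w. (w, l \<bullet> w) \<in> T}"
proof -
  let ?F = "\<lambda>w. at_right (0::real) \<times>\<^sub>F nhds w"
  define f where "f = (\<lambda>(t, w'). (g (z + t *\<^sub>R w') - g z) / ereal t)"
  \<comment> \<open>Bounds on difference quotients become membership in the epigraph; the case of an
    infinite value is included.\<close>
  have quot_le: "f (t, w) \<le> ereal r \<longleftrightarrow> g (z + t *\<^sub>R w) \<le> ereal (c + t * r)" if "t > 0" for t w r
    using not_MInf[of "z + t *\<^sub>R w"] that
    by (cases "g (z + t *\<^sub>R w)") (auto simp: f_def gz divide_le_eq algebra_simps)
  have le_quot: "ereal (l \<bullet> w) \<le> f (t, w)" if "t > 0" for t w
  proof (cases "g (z + t *\<^sub>R w)")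
    case (real r)
    have "g z + ereal (l \<bullet> (z + t *\<^sub>R w - z)) \<le> g (z + t *\<^sub>R w)"
      using l unfolding subdiff_def by blast
    then show ?thesis using real that by (simp add: f_def gz le_divide_eq algebra_simps)
  qed (use not_MInf that in \<open>auto simp: f_def gz\<close>)
  have pos: "eventually (\<lambda>p. fst p > 0) (?F w)" for w :: "real^'m"
    using filterlim_fst[of "at_right (0::real)" "nhds w"] eventually_at_right_less
    by (rule eventually_compose_filterlim[rotated])
  have ge: "ereal (l \<bullet> w) \<le> Liminf (?F w) f" for w
    unfolding le_Liminf_iff
  proof (intro allI impI)
    fix y assume y: "y < ereal (l \<bullet> w)"
    have "((\<lambda>p. ereal (l \<bullet> snd p)) \<longlongrightarrow> ereal (l \<bullet> w)) (?F w)"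
      by (intro tendsto_ereal tendsto_inner tendsto_const filterlim_snd)
    then have "eventually (\<lambda>p. y < ereal (l \<bullet> snd p)) (?F w)"
      using y by (rule order_tendstoD)
    then show "eventually (\<lambda>p. y < f p) (?F w)"
      using pos
    proof eventually_elim
      case (elim p)
      then show ?case using le_quot[of "fst p" "snd p"] by simp
    qed
  qed
  have "ereal (l \<bullet> w) = Liminf (?F w) f \<longleftrightarrow> (w, l \<bullet> w) \<in> T" for w
  proof
    assume T: "(w, l \<bullet> w) \<in> T"
    obtain d where "d > 0" and d: "\<And>t. 0 < t \<Longrightarrow> t < d \<Longrightarrow> norm (t *\<^sub>R (w, l \<bullet> w)) < e"
      using exists_small_multiplier[OF e] by blast
    have small: "f (t, w) \<le> ereal (l \<bullet> w)" if "0 < t" "t < d" for t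
      using T_in_epi[of "t *\<^sub>R w" "t * (l \<bullet> w)"] d[OF that] scale_T[OF T, of t] that
      by (simp add: quot_le)
    have "Liminf (?F w) f \<le> ereal (l \<bullet> w)"
    proof (rule dense_le)
      fix y assume "y < Liminf (?F w) f"
      then obtain y' where "y < y'" "eventually (\<lambda>p. y' < f p) (?F w)"
        by (blast dest: dense less_LiminfD)
      then obtain P Q where "eventually P (at_right (0::real))" "eventually Q (nhds w)"
        and PQ: "\<And>t w'. P t \<Longrightarrow> Q w' \<Longrightarrow> y' < f (t, w')"
        unfolding eventually_prod_filter by blast
      moreover from this obtain b where "b > 0" and b: "\<And>t. 0 < t \<Longrightarrow> t < b \<Longrightarrow> P t"
        unfolding eventually_at_right_field by blast
      ultimately have "y' < f (min b d / 2, w)"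
        using \<open>d > 0\<close> by (intro PQ) (auto intro: eventually_nhds_x_imp_x)
      also have "\<dots> \<le> ereal (l \<bullet> w)"
        using \<open>b > 0\<close> \<open>d > 0\<close> by (intro small) auto
      finally show "y \<le> ereal (l \<bullet> w)" using \<open>y < y'\<close> by simp
    qed
    then show "ereal (l \<bullet> w) = Liminf (?F w) f" using ge by (rule antisym[rotated])
  next
    assume eq: "ereal (l \<bullet> w) = Liminf (?F w) f"
    have "\<exists>p\<in>T. dist p (w, l \<bullet> w) < r" if "r > 0" for r
    proof -
      \<comment> \<open>Half of \<open>r\<close> is slack above the lower limit, the other half
        bounds the distance from \<open>w'\<close> to \<open>w\<close>.\<close>
      have "\<not> ereal (l \<bullet> w + r / 2) \<le> Liminf (?F w) f"
        using that unfolding eq[symmetric] by simp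
      then obtain y where y: "y < ereal (l \<bullet> w + r / 2)" "\<not> eventually (\<lambda>p. y < f p) (?F w)"
        unfolding le_Liminf_iff by blast
      define s where "s = l \<bullet> w + r / 2"
      have near: "eventually (\<lambda>p. dist (snd p) w < r / 2) (?F w)"
        using that by (intro tendstoD[OF filterlim_snd]) simp
      have "\<exists>p. 0 < fst p \<and> dist (snd p) w < r / 2 \<and> \<not> y < f p"
      proof (rule ccontr)
        assume "\<not> ?thesis"
        then have *: "y < f p" if "0 < fst p" "dist (snd p) w < r / 2" for p using that by blast
        have "eventually (\<lambda>p. y < f p) (?F w)"
          by (rule eventually_mono[OF eventually_conj[OF pos near]]) (simp add: *)
        then show False using y(2) by contradiction
      qed
      then obtain p where p: "0 < fst p" "dist (snd p) w < r / 2" "\<not> y < f p"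
        by blast
      define t w' where "t = fst p" and "w' = snd p"
      have t: "0 < t" and w': "dist w' w < r / 2" and "f (t, w') \<le> y"
        using p by (simp_all add: t_def w'_def not_less)
      then have "f (t, w') \<le> ereal s" using y(1) by (simp add: s_def)
      then have "g (z + t *\<^sub>R w') \<le> ereal (c + t * s)" using quot_le t by simp
      then have "(t *\<^sub>R w', t * s) \<in> T" by (rule epi_in_T)
      then have "(w', s) \<in> T" using scale_T[of "t *\<^sub>R w'" "t * s" "1 / t"] t by simp
      moreover have "dist (w', s) (w, l \<bullet> w) < r"
      proof -
        have "dist (w', s) (w, l \<bullet> w) \<le> dist w' w + dist s (l \<bullet> w)"
          using sqrt_sum_squares_le_sum_abs[of "dist w' w" "dist s (l \<bullet> w)"] by (simp add: dist_Pair_Pair)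
        also have "\<dots> < r" using w' that by (simp add: s_def dist_real_def)
        finally show ?thesis .
      qed
      ultimately show ?thesis by blast
    qed
    then show "(w, l \<bullet> w) \<in> T" using closed_T closure_approachable closure_closed by blast
  qed
  then show ?thesis unfolding critical_cone_def subderiv_def f_def by blast
qed

text \<open>For a subgradient \<open>m = l + v\<close> at \<open>z\<close>, the condition
  \<open>(u, m \<bullet> u) \<in> T\<close> says that its affine minorant touches \<open>g\<close>
  at \<open>z + u\<close>, so it supports \<open>g\<close> there as well. Conversely, adding a
  vector of \<open>T\<close> to \<open>(u, a)\<close> stays in \<open>T\<close>, so support at
  \<open>z + u\<close> gives \<open>m \<bullet> w \<le> b\<close> on all of
  \<open>T\<close>.\<close>

lemma subdiff_locally:
  assumes l: "l \<in> subdiff g z"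
  obtains d where "d > 0"
    "\<And>u v. norm u < d \<Longrightarrow> norm v < d \<Longrightarrow>
       l + v \<in> subdiff g (z + u) \<longleftrightarrow> l + v \<in> subdiff g z \<and> (u, (l + v) \<bullet> u) \<in> T"
proof -
  \<comment> \<open>The bound 1 gives \<open>norm m \<le> norm l + 1\<close>; the other bound then
    keeps \<open>(u, a)\<close> shorter than \<open>e\<close> for every height \<open>a\<close>
    between \<open>l \<bullet> u\<close> and \<open>m \<bullet> u\<close>.\<close>
  define d where "d = min 1 (e / (norm l + 3))"
  have "d > 0" using e by (simp add: d_def add_nonneg_pos)
  show ?thesis
  proof (rule that[OF \<open>d > 0\<close>])
    fix u v :: "real^'m" assume u: "norm u < d" and v: "norm v < d"
    define m where "m = l + v"
    have "norm m \<le> norm l + 1"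
      using v norm_triangle_ineq[of l v] by (simp add: m_def d_def)
    have ue: "norm u * (norm l + 3) < e"
    proof -
      have "norm u < e / (norm l + 3)" using u by (simp add: d_def)
      then show ?thesis by (subst (asm) pos_less_divide_eq) (auto simp: add_nonneg_pos)
    qed
    have small: "norm (u, a) < e" if "l \<bullet> u \<le> a" "a \<le> m \<bullet> u" for a
    proof -
      have "\<bar>l \<bullet> u\<bar> \<le> (norm l + 1) * norm u"
        using Cauchy_Schwarz_ineq2[of l u] norm_ge_zero[of u] unfolding distrib_right mult_1 by linarith
      moreover have "\<bar>m \<bullet> u\<bar> \<le> (norm l + 1) * norm u"
        using Cauchy_Schwarz_ineq2[of m u] mult_right_mono[OF \<open>norm m \<le> norm l + 1\<close> norm_ge_zero[of u]]
        by linarith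
      ultimately have "\<bar>a\<bar> \<le> (norm l + 1) * norm u" using that by linarith
      then have "norm (u, a) \<le> norm u + (norm l + 1) * norm u"
        using norm_Pair_le[of u a] by simp
      also have "\<dots> \<le> norm u * (norm l + 3)" by (simp add: algebra_simps)
      finally show ?thesis using ue by simp
    qed
    show "m \<in> subdiff g (z + u) \<longleftrightarrow> m \<in> subdiff g z \<and> (u, m \<bullet> u) \<in> T"
    proof
      assume m: "m \<in> subdiff g (z + u)"
      then obtain r where r: "g (z + u) = ereal r" by (auto simp: subdiff_def)
      have msub: "ereal r + ereal (m \<bullet> (y - (z + u))) \<le> g y" for y
        using m r by (auto simp: subdiff_def)
      define a where "a = r - c"
      have "a \<le> m \<bullet> u" using msub[of z] by (simp add: gz a_def)
      have ua: "(u, a) \<in> T" by (rule epi_in_T) (simp add: r a_def)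
      then have "l \<bullet> u \<le> a" using l by (auto simp: subdiff_iff)
      then have na: "norm (u, a) < e" using small \<open>a \<le> m \<bullet> u\<close> by blast
      have "m \<bullet> w \<le> b" if wb: "(w, b) \<in> T" for w b
      proof -
        obtain d' where "d' > 0" and d': "\<And>t. 0 < t \<Longrightarrow> t < d' \<Longrightarrow> norm (t *\<^sub>R (w, b)) < e - norm (u, a)"
          using exists_small_multiplier[of "e - norm (u, a)" "(w, b)"] na by (metis diff_gt_0_iff_gt)
        define t where "t = d' / 2"
        have t: "0 < t" "t < d'" using \<open>d' > 0\<close> by (auto simp: t_def)
        have "(u + t *\<^sub>R w, a + t * b) \<in> T"
          using convex_cone_add[OF cone_T ua scale_T[OF wb, of t]] t by simp
        moreover have "norm (u + t *\<^sub>R w, a + t * b) < e"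
          using d'[OF t] norm_triangle_ineq[of "(u, a)" "t *\<^sub>R (w, b)"] by simp
        ultimately have "g (z + (u + t *\<^sub>R w)) \<le> ereal (c + (a + t * b))" by (intro T_in_epi)
        moreover have "ereal r + ereal (m \<bullet> (t *\<^sub>R w)) \<le> g (z + (u + t *\<^sub>R w))"
          using msub[of "z + (u + t *\<^sub>R w)"] by (simp add: algebra_simps)
        ultimately have "ereal r + ereal (m \<bullet> (t *\<^sub>R w)) \<le> ereal (c + (a + t * b))"
          by (rule order_trans[rotated])
        then have "t * (m \<bullet> w) \<le> t * b" by (simp add: a_def)
        then show ?thesis using t by simp
      qed
      then show "m \<in> subdiff g z \<and> (u, m \<bullet> u) \<in> T"
        using ua \<open>a \<le> m \<bullet> u\<close> upward_T by (auto simp: subdiff_iff)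
    next
      assume m: "m \<in> subdiff g z \<and> (u, m \<bullet> u) \<in> T"
      then have "l \<bullet> u \<le> m \<bullet> u" using l by (auto simp: subdiff_iff)
      then have "g (z + u) \<le> ereal (c + m \<bullet> u)" using m by (intro T_in_epi small) auto
      then obtain r where r: "g (z + u) = ereal r" "r \<le> c + m \<bullet> u" by (rule real_value)
      have msub: "ereal c + ereal (m \<bullet> (y - z)) \<le> g y" for y
        using m by (auto simp: subdiff_def gz)
      have "ereal r + ereal (m \<bullet> (y - (z + u))) \<le> g y" for y
      proof -
        have "ereal r + ereal (m \<bullet> (y - (z + u))) \<le> ereal c + ereal (m \<bullet> (y - z))"
          using r(2) by (simp add: algebra_simps)
        then show ?thesis using msub by (rule order_trans)
      qed
      then show "m \<in> subdiff g (z + u)" by (simp add: subdiff_def r)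
    qed
  qed
qed

lemma polyhedral_critical_cone:
  assumes l: "l \<in> subdiff g z"
  shows "polyhedron (critical_cone g z l)" "convex_cone (critical_cone g z l)"
proof -
  let ?h = "\<lambda>w. (w, l \<bullet> w)"
  have K: "critical_cone g z l = ?h -` T" using critical_cone_eq[OF l] by auto
  have lin: "linear ?h" by (auto simp: linear_iff inner_add_right)
  show "polyhedron (critical_cone g z l)"
    unfolding K using lin polyhedron_T by (rule polyhedron_linear_vimage)
  show "convex_cone (critical_cone g z l)"
    unfolding K using lin cone_T by (rule convex_cone_linear_vimage)
qed

text \<open>By finite generation only the inequalities at \<open>D\<close> matter. Those strict at
  \<open>l\<close> survive a small change \<open>v\<close>, and those tight at \<open>l\<close>
  belong to directions in the critical cone.\<close>

lemma subdiff_near: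
  assumes l: "l \<in> subdiff g z"
  obtains d where "d > 0"
    "\<And>v. norm v < d \<Longrightarrow> l + v \<in> subdiff g z \<longleftrightarrow> (\<forall>k\<in>critical_cone g z l. v \<bullet> k \<le> 0)"
proof -
  have K: "critical_cone g z l = {w. (w, l \<bullet> w) \<in> T}" by (rule critical_cone_eq[OF l])
  have D: "m \<in> subdiff g z \<longleftrightarrow> (\<forall>(w, a)\<in>D. m \<bullet> w \<le> a)" for m
  proof
    assume "m \<in> subdiff g z"
    then show "\<forall>(w, a)\<in>D. m \<bullet> w \<le> a" unfolding subdiff_iff T by (auto intro: hull_inc)
  next
    assume "\<forall>(w, a)\<in>D. m \<bullet> w \<le> a"
    \<comment> \<open>Pairing with \<open>(m, - 1)\<close> turns
      \<open>m \<bullet> w \<le> a\<close> into a linear condition, which passes from generators to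
      the hull.\<close>
    then have "(m, - 1) \<bullet> p \<le> 0" if "p \<in> T" for p
      using that unfolding T by (intro convex_cone_hull_inner_nonpos[of p D]) auto
    then show "m \<in> subdiff g z" unfolding subdiff_iff by force
  qed
  let ?I = "{p \<in> D. l \<bullet> fst p < snd p}"
  have "open (\<Inter>(w, a)\<in>?I. {v. w \<bullet> v < a - l \<bullet> w})"
    using finD by (intro open_INT) (auto simp: open_halfspace_lt)
  moreover have "0 \<in> (\<Inter>(w, a)\<in>?I. {v. w \<bullet> v < a - l \<bullet> w})" by auto
  ultimately obtain d where "d > 0" and d: "ball 0 d \<subseteq> (\<Inter>(w, a)\<in>?I. {v. w \<bullet> v < a - l \<bullet> w})"
    by (rule openE)
  show ?thesis
  proof (rule that[OF \<open>d > 0\<close>])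
    fix v :: "real^'m" assume v: "norm v < d"
    show "l + v \<in> subdiff g z \<longleftrightarrow> (\<forall>k\<in>critical_cone g z l. v \<bullet> k \<le> 0)"
    proof
      assume "l + v \<in> subdiff g z"
      then show "\<forall>k\<in>critical_cone g z l. v \<bullet> k \<le> 0"
        by (auto simp: K subdiff_iff inner_add_left)
    next
      assume vK: "\<forall>k\<in>critical_cone g z l. v \<bullet> k \<le> 0"
      have "(l + v) \<bullet> w \<le> a" if wa: "(w, a) \<in> D" for w a
      proof (cases "l \<bullet> w < a")
        case True
        have "v \<in> ball 0 d" using v by simp
        then have "w \<bullet> v < a - l \<bullet> w" using d wa True by fastforce
        then show ?thesis by (simp add: inner_add_left inner_commute[of v w])
      next
        case False
        have "l \<bullet> w \<le> a" using l wa D by blast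
        then have "a = l \<bullet> w" using False by simp
        moreover have "(w, a) \<in> T" using wa unfolding T by (rule hull_inc)
        ultimately show ?thesis using vK by (simp add: K inner_add_left)
      qed
      then show "l + v \<in> subdiff g z" unfolding D by blast
    qed
  qed
qed

text \<open>Robinson's reduction: near \<open>(z, l)\<close>, being a subgradient at
  \<open>z\<close> becomes polarity to the critical cone, and the touching condition becomes
  \<open>u\<close> critical together with \<open>v \<bullet> u = 0\<close>.\<close>

lemma gph_subdiff_agrees_near:
  assumes l: "l \<in> subdiff g z"
  shows "agrees_near (gph (subdiff g)) (z, l) (gph (normal_cone_map (critical_cone g z l)))"
proof -
  let ?K = "critical_cone g z l"
  have K: "?K = {w. (w, l \<bullet> w) \<in> T}" by (rule critical_cone_eq[OF l])
  obtain d1 where "d1 > 0" and d1: "\<And>u v. norm u < d1 \<Longrightarrow> norm v < d1 \<Longrightarrow>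
       l + v \<in> subdiff g (z + u) \<longleftrightarrow> l + v \<in> subdiff g z \<and> (u, (l + v) \<bullet> u) \<in> T"
    using subdiff_locally[OF l] by blast
  obtain d2 where "d2 > 0"
    and d2: "\<And>v. norm v < d2 \<Longrightarrow> l + v \<in> subdiff g z \<longleftrightarrow> (\<forall>k\<in>?K. v \<bullet> k \<le> 0)"
    using subdiff_near[OF l] by blast
  have eq: "l + v \<in> subdiff g z \<and> (u, (l + v) \<bullet> u) \<in> T \<longleftrightarrow>
        u \<in> ?K \<and> (\<forall>k\<in>?K. v \<bullet> k \<le> 0) \<and> v \<bullet> u = 0" if v: "norm v < d2 / 2" for u v
  proof
    assume *: "l + v \<in> subdiff g z \<and> (u, (l + v) \<bullet> u) \<in> T"
    have "norm v < d2" using v norm_ge_zero[of v] by linarith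
    with * d2 have vK: "\<forall>k\<in>?K. v \<bullet> k \<le> 0" by blast
    \<comment> \<open>\<open>l + v\<close> maximises \<open>\<lambda>m. m \<bullet> u\<close> over the subdifferential; comparing it with \<open>l + 2 v\<close> and \<open>l\<close>
      forces \<open>v \<bullet> u = 0\<close>.\<close>
    then have "l + 2 *\<^sub>R v \<in> subdiff g z" using v by (subst d2) auto
    then have "(l + 2 *\<^sub>R v) \<bullet> u \<le> (l + v) \<bullet> u" "l \<bullet> u \<le> (l + v) \<bullet> u"
      using * l unfolding subdiff_iff by blast+
    then have "v \<bullet> u = 0" by (simp add: inner_add_left)
    then show "u \<in> ?K \<and> (\<forall>k\<in>?K. v \<bullet> k \<le> 0) \<and> v \<bullet> u = 0"
      using * vK by (simp add: K inner_add_left)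
  next
    assume *: "u \<in> ?K \<and> (\<forall>k\<in>?K. v \<bullet> k \<le> 0) \<and> v \<bullet> u = 0"
    have "norm v < d2" using v norm_ge_zero[of v] by linarith
    then show "l + v \<in> subdiff g z \<and> (u, (l + v) \<bullet> u) \<in> T"
      using * d2 by (simp add: K inner_add_left)
  qed
  show ?thesis
    unfolding agrees_near_def
  proof (intro exI conjI allI impI)
    show "min d1 (d2 / 2) > 0" using \<open>d1 > 0\<close> \<open>d2 > 0\<close> by simp
    fix p :: "(real^'m) \<times> (real^'m)" assume p: "norm p < min d1 (d2 / 2)"
    obtain u v where uv: "p = (u, v)" by (cases p)
    have "norm u < min d1 (d2 / 2)" "norm v < min d1 (d2 / 2)"
      using p norm_fst_le[of u v] norm_snd_le[of v u] unfolding uv by linarith+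
    then show "(z, l) + p \<in> gph (subdiff g) \<longleftrightarrow> p \<in> gph (normal_cone_map ?K)"
      using d1[of u v] eq[of v u] unfolding uv in_gph_normal_cone_map[OF polyhedral_critical_cone(2)[OF l]]
      by (simp add: gph_def)
  qed
qed

text \<open>If \<open>w\<close> is not critical, a hyperplane separates
  \<open>(w, l \<bullet> w)\<close> from \<open>T\<close>. Its normal yields a subgradient whose
  value at \<open>w\<close> exceeds that of \<open>l\<close>: \<open>- n / s\<close> when the
  vertical component \<open>s\<close> is positive, \<open>l - n\<close> when it is 0.\<close>

lemma normal_direction_in_critical_cone:
  assumes l: "l \<in> subdiff g z" and w: "\<And>m. m \<in> subdiff g z \<Longrightarrow> m \<bullet> w \<le> l \<bullet> w"
  shows "w \<in> critical_cone g z l"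
proof (rule ccontr)
  assume "w \<notin> critical_cone g z l"
  then have "(w, l \<bullet> w) \<notin> T" by (simp add: critical_cone_eq[OF l])
  then obtain a b where ab: "a \<bullet> (w, l \<bullet> w) < b" "\<And>p. p \<in> T \<Longrightarrow> b < a \<bullet> p"
    using separating_hyperplane_closed_point[OF polyhedron_imp_convex[OF polyhedron_T] closed_T] by metis
  have "b < 0" using ab(2)[OF convex_cone_contains_0[OF cone_T]] by simp
  have pos: "0 \<le> a \<bullet> p" if "p \<in> T" for p
  proof (rule ccontr)
    assume n: "\<not> 0 \<le> a \<bullet> p"
    \<comment> \<open>The factor is positive and the scaled point has inner product exactly
      \<open>b\<close> with \<open>a\<close>, against the strict separation.\<close>
    then have "(b / (a \<bullet> p)) *\<^sub>R p \<in> T"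
      using convex_cone_scaleR[OF cone_T _ that, of "b / (a \<bullet> p)"] \<open>b < 0\<close> by (simp add: divide_nonpos_neg)
    then show False using ab(2) n by fastforce
  qed
  obtain n s where a: "a = (n, s)" by (cases a)
  have s: "0 \<le> s" using pos[OF vertical_in_T[of 1]] by (simp add: a)
  have neg: "n \<bullet> w + s * (l \<bullet> w) < 0" using ab(1) \<open>b < 0\<close> by (simp add: a)
  show False
  proof (cases "s = 0")
    case True
    have "l - n \<in> subdiff g z"
      using l pos unfolding subdiff_iff by (force simp: a True inner_diff_left)
    then show False using w[of "l - n"] neg by (simp add: True inner_diff_left)
  next
    case False
    then have "s > 0" using s by simp
    have "- (1 / s) *\<^sub>R n \<in> subdiff g z"
      unfolding subdiff_iff
    proof clarify
      fix y r assume "(y, r) \<in> T"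
      then have "0 \<le> n \<bullet> y + s * r" using pos by (force simp: a)
      then show "(- (1 / s) *\<^sub>R n) \<bullet> y \<le> r" using \<open>s > 0\<close> by (simp add: field_simps)
    qed
    then show False using w[of "- (1 / s) *\<^sub>R n"] neg \<open>s > 0\<close> by (simp add: field_simps)
  qed
qed

text \<open>Critical directions are those whose functional is maximised over the subdifferential at
  \<open>l\<close>. At a relative interior point such a functional is constant, so the reversed
  direction is critical too; elsewhere a supporting hyperplane gives one that is not constant, which
  symmetry excludes.\<close>

lemma rel_interior_subdiff_iff:
  assumes l: "l \<in> subdiff g z"
  shows "l \<in> rel_interior (subdiff g z) \<longleftrightarrow> subspace (critical_cone g z l)"
proof
  let ?K = "critical_cone g z l"
  have K: "w \<in> ?K \<longleftrightarrow> (w, l \<bullet> w) \<in> T" for w using critical_cone_eq[OF l] by auto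
  assume ri: "l \<in> rel_interior (subdiff g z)"
  have "- w \<in> ?K" if w: "w \<in> ?K" for w
  proof (rule normal_direction_in_critical_cone[OF l])
    fix m assume m: "m \<in> subdiff g z"
    \<comment> \<open>The segment from \<open>m\<close> to \<open>l\<close> can be prolonged beyond
      \<open>l\<close> inside the subdifferential.\<close>
    then obtain r where r: "r > 1" "(1 - r) *\<^sub>R m + r *\<^sub>R l \<in> subdiff g z"
      using ri convex_rel_interior_iff[OF convex_subdiff, of l] l by blast
    then have "((1 - r) *\<^sub>R m + r *\<^sub>R l) \<bullet> w \<le> l \<bullet> w" using w K unfolding subdiff_iff by blast
    then have "(r - 1) * (l \<bullet> w) \<le> (r - 1) * (m \<bullet> w)" by (simp add: inner_add_left algebra_simps)
    then show "m \<bullet> - w \<le> l \<bullet> - w" using r(1) by simp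
  qed
  then show "subspace ?K"
    unfolding subspace_convex_cone_symmetric using polyhedral_critical_cone(2)[OF l] by blast
next
  let ?K = "critical_cone g z l"
  assume sub: "subspace ?K"
  show "l \<in> rel_interior (subdiff g z)"
  proof (rule ccontr)
    assume "l \<notin> rel_interior (subdiff g z)"
    then obtain a where a: "\<And>m. m \<in> subdiff g z \<Longrightarrow> a \<bullet> l \<le> a \<bullet> m"
      "\<And>m. m \<in> rel_interior (subdiff g z) \<Longrightarrow> a \<bullet> l < a \<bullet> m"
      using supporting_hyperplane_rel_boundary[OF convex_subdiff l] by metis
    have "- a \<in> ?K"
      by (rule normal_direction_in_critical_cone[OF l]) (use a(1) in \<open>simp add: inner_commute\<close>)
    then have "a \<in> ?K" using subspace_neg[OF sub] by fastforce
    then have aT: "(a, l \<bullet> a) \<in> T" using critical_cone_eq[OF l] by auto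
    obtain m where m: "m \<in> rel_interior (subdiff g z)"
      using l convex_subdiff rel_interior_eq_empty by blast
    then have "m \<in> subdiff g z" using rel_interior_subset by blast
    then have "m \<bullet> a \<le> l \<bullet> a" using aT by (auto simp: subdiff_iff)
    then show False using a(2)[OF m] by (simp add: inner_commute)
  qed
qed

end

subsection \<open>Polyhedral functions\<close>

lemma local_epigraph_cone_exists:
  assumes g: "polyhedral_fun g" and l: "l \<in> subdiff g z"
  obtains c T D e where "local_epigraph_cone g z c T D e"
proof -
  have not_MInf: "g y \<noteq> -\<infinity>" for y
    using g by (simp add: polyhedral_fun_def proper_fun_def)
  obtain c where c: "g z = ereal c" using l by (auto simp: subdiff_def)
  have "polyhedron (epigraph g)" using g by (simp add: polyhedral_fun_def)
  moreover have "(z, c) \<in> epigraph g" by (simp add: epigraph_def c)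
  ultimately obtain T e where T: "polyhedron T" "convex_cone T" and e: "e > 0"
    and 1: "\<And>d. (z, c) + d \<in> epigraph g \<Longrightarrow> d \<in> T"
    and 2: "\<And>d. norm d < e \<Longrightarrow> d \<in> T \<Longrightarrow> (z, c) + d \<in> epigraph g"
    using polyhedron_locally_cone[of "epigraph g" "(z, c)"] by metis
  obtain D where D: "finite D" "T = convex_cone hull D"
    using polyhedral_cone_finitely_generated[OF T] by blast
  have "local_epigraph_cone g z c T D e"
  proof
    show "(w, a) \<in> T" if "g (z + w) \<le> ereal (c + a)" for w a
      using that by (intro 1) (simp add: epigraph_def)
    show "g (z + w) \<le> ereal (c + a)" if "norm (w, a) < e" "(w, a) \<in> T" for w a
      using 2[OF that] by (simp add: epigraph_def)
  qed (use not_MInf c D e in auto)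
  then show ?thesis by (rule that)
qed

lemma polyhedral_subdiff_local_structure:
  assumes g: "polyhedral_fun g" and zl: "(z, l) \<in> gph (subdiff g)"
  defines "K \<equiv> critical_cone g z l"
  shows "polyhedron K" "convex_cone K"
    and "agrees_near (gph (subdiff g)) (z, l) (gph (normal_cone_map K))"
    and "l \<in> rel_interior (subdiff g z) \<longleftrightarrow> subspace K"
proof -
  have l: "l \<in> subdiff g z" using zl by (simp add: gph_def)
  obtain c T D e where "local_epigraph_cone g z c T D e"
    using g l by (rule local_epigraph_cone_exists)
  then interpret local_epigraph_cone g z c T D e .
  show "polyhedron K" "convex_cone K"
    and "agrees_near (gph (subdiff g)) (z, l) (gph (normal_cone_map K))"
    and "l \<in> rel_interior (subdiff g z) \<longleftrightarrow> subspace K"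
    unfolding K_def using polyhedral_critical_cone[OF l] gph_subdiff_agrees_near[OF l] rel_interior_subdiff_iff[OF l]
    by blast+
qed

lemma gph_graph_deriv: "gph (graph_deriv F x y) = tangent_cone (gph F) (x, y)"
  by (auto simp: gph_def graph_deriv_def)

lemma gph_strict_graph_deriv:
  "gph (strict_graph_deriv F x y) = outer_limit (strict_filter (gph F) (x, y)) (strict_quot (gph F))"
  by (auto simp: gph_def strict_graph_deriv_def)

lemma gph_eq_iff: "gph F = gph H \<longleftrightarrow> F = H"
  by (auto simp: gph_def fun_eq_iff set_eq_iff)

lemma subspace_differences:
  assumes "subspace M"
  shows "{a - b | a b. a \<in> M \<and> b \<in> M} = M"
proof (intro equalityI subsetI)
  show "x \<in> {a - b | a b. a \<in> M \<and> b \<in> M}" if "x \<in> M" for x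
    using that subspace_0[OF assms] by (intro CollectI exI[of _ x] exI[of _ 0]) simp
qed (use subspace_diff[OF assms] in blast)

theorem theorem3p5:
  fixes g :: "real^'m \<Rightarrow> ereal" and zb lb :: "real^'m"
  assumes "polyhedral_fun g"
    and "(zb, lb) \<in> gph (subdiff g)"
  defines "K \<equiv> critical_cone g zb lb"
  shows "(gph (graph_deriv (subdiff g) zb lb) = tangent_cone (gph (subdiff g)) (zb, lb)
          \<and> tangent_cone (gph (subdiff g)) (zb, lb) = gph (normal_cone_map K))
    \<and> gph (strict_graph_deriv (subdiff g) zb lb)
       = {a - b | a b. a \<in> gph (normal_cone_map K) \<and> b \<in> gph (normal_cone_map K)}
    \<and> (lb \<in> rel_interior (subdiff g zb) \<longleftrightarrow>
       (\<exists>U. open U \<and> (zb, lb) \<in> U \<and>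
          (\<forall>z l. (z, l) \<in> U \<inter> gph (subdiff g) \<longrightarrow>
             strictly_proto_diff (subdiff g) z l \<and>
             strict_graph_deriv (subdiff g) z l = graph_deriv (subdiff g) z l)))"
proof -
  let ?G = "gph (subdiff g)" and ?M = "gph (normal_cone_map K)"
  note loc = polyhedral_subdiff_local_structure[OF assms(1,2), folded K_def]
  have closed_diffs: "closed {a - b | a b. a \<in> ?M \<and> b \<in> ?M}"
    using loc(1,2) by (rule closed_gph_normal_cone_map_differences)
  have M: "conic ?M" "closed ?M"
    using loc(2) polyhedron_imp_closed[OF loc(1)]
    by (auto intro: conic_gph_normal_cone_map closed_gph_normal_cone_map)
  \<comment> \<open>The point \<open>p\<close> is left general because the converse construction in
    the relative interior case uses the same \<open>?M\<close> at all nearby graph points.\<close>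
  have tangent: "tangent_cone ?G p = ?M"
    and outer: "outer_limit (strict_filter ?G p) (strict_quot ?G) = {a - b | a b. a \<in> ?M \<and> b \<in> ?M}"
    if "agrees_near ?G p ?M" for p
    using tangent_cone_agrees_near[OF that M] strict_outer_limit_agrees_near[OF that M(1) closed_diffs]
    by blast+
  have "lb \<in> rel_interior (subdiff g zb) \<longleftrightarrow>
       (\<exists>U. open U \<and> (zb, lb) \<in> U \<and>
          (\<forall>z l. (z, l) \<in> U \<inter> ?G \<longrightarrow>
             strictly_proto_diff (subdiff g) z l \<and>
             strict_graph_deriv (subdiff g) z l = graph_deriv (subdiff g) z l))" (is "_ \<longleftrightarrow> ?R")
  proof
    assume "lb \<in> rel_interior (subdiff g zb)"
    then have sub: "subspace ?M" using loc(4) subspace_gph_normal_cone_map by blast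
    obtain U where U: "open U" "(zb, lb) \<in> U"
      and near: "\<And>p. p \<in> U \<Longrightarrow> p \<in> ?G \<Longrightarrow> agrees_near ?G p ?M"
      using agrees_near_subspace_shift[OF loc(3) sub] by blast
    have "strictly_proto_diff (subdiff g) z l \<and>
        strict_graph_deriv (subdiff g) z l = graph_deriv (subdiff g) z l"
      if "(z, l) \<in> U \<inter> ?G" for z l
    proof -
      have zl: "agrees_near ?G (z, l) ?M" using near that by blast
      let ?F = "strict_filter ?G (z, l)"
      have out: "outer_limit ?F (strict_quot ?G) = ?M"
        using outer[OF zl] subspace_differences[OF sub] by simp
      moreover have "inner_limit ?F (strict_quot ?G) \<subseteq> outer_limit ?F (strict_quot ?G)"
        using that by (intro inner_limit_subset_outer_limit strict_filter_neq_bot) simp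
      ultimately have "strictly_proto_diff (subdiff g) z l"
        using strict_inner_limit_subspace[OF zl sub] unfolding strictly_proto_diff_def by blast
      moreover have "gph (strict_graph_deriv (subdiff g) z l) = gph (graph_deriv (subdiff g) z l)"
        by (simp only: gph_graph_deriv gph_strict_graph_deriv out tangent[OF zl])
      ultimately show ?thesis by (simp add: gph_eq_iff)
    qed
    with U show ?R by blast
  next
    assume ?R
    then have "strict_graph_deriv (subdiff g) zb lb = graph_deriv (subdiff g) zb lb"
      using assms(2) by blast
    \<comment> \<open>At \<open>(zb, lb)\<close> itself, equality of the two derivatives says that
      \<open>?M\<close> is closed under differences.\<close>
    then have eq: "{a - b | a b. a \<in> ?M \<and> b \<in> ?M} = ?M"
      using gph_graph_deriv[of "subdiff g" zb lb] gph_strict_graph_deriv[of "subdiff g" zb lb]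
        tangent[OF loc(3)] outer[OF loc(3)] by simp
    have "- w \<in> K" if "w \<in> K" for w
    proof -
      \<comment> \<open>The graph contains \<open>(w, 0)\<close> for every \<open>w\<close> in
        \<open>K\<close>; closure under differences then puts \<open>(- w, 0)\<close> into
        it.\<close>
      have "(0, 0) \<in> ?M" "(w, 0) \<in> ?M"
        using that convex_cone_contains_0[OF loc(2)] by (simp_all add: in_gph_normal_cone_map[OF loc(2)])
      then have "(0, 0) - (w, 0) \<in> ?M" by (subst eq[symmetric]) blast
      then show ?thesis by (simp add: in_gph_normal_cone_map[OF loc(2)])
    qed
    then show "lb \<in> rel_interior (subdiff g zb)"
      unfolding loc(4) subspace_convex_cone_symmetric using loc(2) by blast
  qed
  then show ?thesis
    using tangent[OF loc(3)] outer[OF loc(3)] by (simp add: gph_graph_deriv gph_strict_graph_deriv)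
qed

end
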